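(* Let $G=(V,E)$ be a connected block graph. Then $rad(G)\leq \alpha_{\min}(G)$.
   Context: All graphs are finite, simple and undirected. A block of a graph is a maximal 2-connected subgraph; $G$ is a block graph if every block of $G$ is a complete graph (clique). For a connected graph, $d(u,v)$ is the length of a shortest $u$–$v$ path, $\epsilon_G(u)=\max_{v\in V}d(u,v)$ is the eccentricity of $u$, and $rad(G)=\min_{v\in V}\epsilon_G(v)$ is the radius. For a vertex $v$, $\alpha(G,v)$ denotes the maximum size of an independent set of $G$ containing $v$, and $\alpha_{\min}(G)=\min_{v\in V(G)}\alpha(G,v)$. *)

theory Defs
  imports "Graph_Theory.Kuratowski"
begin

text \<open>
  As in \<^theory>\<open>Graph_Theory.Digraph\<close>, a finite simple undirected graph is a finite symmetric
  digraph without loops and parallel arcs (locale \<^locale>\<open>graph\<close>); an edge is a pair of opposite arcs.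
\<close>

subsection \<open>Blocks\<close>

text \<open>
  The one-vertex graph and the complete graph on two vertices count as 2-connected, so that the
  blocks of a connected graph with an edge include its bridges. Requiring at least three vertices
  instead gives the same block graphs, see \<open>block_graph_iff_ge3\<close> below. The guard
  \<^term>\<open>verts H \<noteq> {v}\<close> is needed because the null graph is not \<^const>\<open>connected\<close>.
\<close>
definition two_connected :: "('a,'b) pre_digraph \<Rightarrow> bool" where
  "two_connected H \<longleftrightarrow> graph H \<and> connected H \<and>
     (\<forall>v \<in> verts H. verts H \<noteq> {v} \<longrightarrow> connected (pre_digraph.del_vert H v))"

definition block :: "('a,'b) pre_digraph \<Rightarrow> ('a,'b) pre_digraph \<Rightarrow> bool" where
  "block G B \<longleftrightarrow> pre_digraph.max_subgraph G two_connected B"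

definition complete :: "('a,'b) pre_digraph \<Rightarrow> bool" where
  "complete G \<longleftrightarrow> (\<exists>n. complete_digraph n G)"

definition block_graph :: "('a,'b) pre_digraph \<Rightarrow> bool" where
  "block_graph G \<longleftrightarrow> (\<forall>B. block G B \<longrightarrow> complete B)"

subsection \<open>Distance, eccentricity and radius\<close>

text \<open>Only meaningful if \<open>v\<close> is reachable from \<open>u\<close>.\<close>
definition distance :: "('a,'b) pre_digraph \<Rightarrow> 'a \<Rightarrow> 'a \<Rightarrow> nat" where
  "distance G u v = (LEAST n. \<exists>p. pre_digraph.apath G u p v \<and> length p = n)"

definition eccentricity :: "('a,'b) pre_digraph \<Rightarrow> 'a \<Rightarrow> nat" where
  "eccentricity G u = Max ((\<lambda>v. distance G u v) ` verts G)"

definition radius :: "('a,'b) pre_digraph \<Rightarrow> nat" where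
  "radius G = Min ((\<lambda>v. eccentricity G v) ` verts G)"

subsection \<open>Independent sets\<close>

definition independent_set :: "('a,'b) pre_digraph \<Rightarrow> 'a set \<Rightarrow> bool" where
  "independent_set G S \<longleftrightarrow> S \<subseteq> verts G \<and> (\<forall>u \<in> S. \<forall>v \<in> S. \<not> u \<rightarrow>\<^bsub>G\<^esub> v)"

definition alpha_at :: "('a,'b) pre_digraph \<Rightarrow> 'a \<Rightarrow> nat" where
  "alpha_at G v = Max (card ` {S. independent_set G S \<and> v \<in> S})"

definition alpha_min :: "('a,'b) pre_digraph \<Rightarrow> nat" where
  "alpha_min G = Min ((\<lambda>v. alpha_at G v) ` verts G)"

subsection \<open>Blocks with at least three vertices\<close>

lemma complete_if_card_le_2:
  assumes "graph H" "connected H" "card (verts H) \<le> 2"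
  shows "complete H"
proof -
  interpret graph H by fact
  have adj: "u \<rightarrow>\<^bsub>H\<^esub> v" if uv: "u \<in> verts H" "v \<in> verts H" "u \<noteq> v" for u v
  proof -
    have "u \<rightarrow>\<^sup>*\<^bsub>mk_symmetric H\<^esub> v"
      using assms(2) uv by (simp add: connected_def strongly_connected_def mk_symmetric_def)
    then have "u \<rightarrow>\<^sup>*\<^bsub>H\<^esub> v"
      by (simp only: reachable_mk_symmetric_eq[OF sym_arcs])
    then obtain w where w: "u \<rightarrow>\<^bsub>H\<^esub> w"
      by (rule converse_reachable_cases) (use uv(3) in blast)+
    then have "w \<in> verts H" "w \<noteq> u"
      by (blast intro: adj_in_verts, blast dest: adj_not_same)
    moreover have "verts H = {u,v}"
      using uv assms(3) card_seteq[of "verts H" "{u,v}"] by simp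
    ultimately show ?thesis using w by blast
  qed
  have "arcs_ends H = {(u,v). (u,v) \<in> verts H \<times> verts H \<and> u \<noteq> v}"
    using adj by (blast intro: adj_in_verts dest: adj_not_same)
  then show ?thesis
    using assms(1) by (auto simp: complete_def complete_digraph_def)
qed

lemma block_graph_iff_ge3:
  assumes "graph G"
  shows "block_graph G \<longleftrightarrow>
    (\<forall>B. pre_digraph.max_subgraph G (\<lambda>H. 3 \<le> card (verts H) \<and> two_connected H) B \<longrightarrow> complete B)"
proof -
  interpret graph G by fact
  have mono: "3 \<le> card (verts H')" if "subgraph H H'" "subgraph H' G" "3 \<le> card (verts H)" for H H'
  proof -
    have "verts H \<subseteq> verts H'" "finite (verts H')"
      using that finite_subset[of "verts H'" "verts G"] by (auto simp: subgraph_def)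
    then have "card (verts H) \<le> card (verts H')" by (intro card_mono)
    with that(3) show ?thesis by simp
  qed
  have iff: "max_subgraph (\<lambda>H. 3 \<le> card (verts H) \<and> two_connected H) B
      \<longleftrightarrow> 3 \<le> card (verts B) \<and> block G B" for B
    unfolding max_subgraph_def block_def using mono by blast
  have small: "complete B" if "block G B" "\<not> 3 \<le> card (verts B)" for B
    using that by (auto simp: block_def max_subgraph_def two_connected_def intro: complete_if_card_le_2)
  show ?thesis unfolding iff block_graph_def using small by blast
qed

end

(*
  Let x, y be a diametral pair at distance D. A vertex inside a geodesic of a block graph separates
  its two neighbours on it, since otherwise the three would lie in a common block, i.e. clique, and
  the geodesic could be shortened. Hence every walk from w to x or every walk from w to y passes through the middle vertex
  z of an x-y geodesic, so that d(z,w) <= D - floor(D/2), i.e. the radius is at most ceil(D/2). On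
  the other side every vertex v lies in an independent set of size ceil(D/2): only vertices of the
  geodesic with at most two steps between them can lie within distance one of v.
*)
theory Submission
  imports Defs
begin

text \<open>Reserves the arrow for adjacency; as function-set notation it would be
  ambiguous.\<close>

unbundle no funcset_syntax

subsection \<open>Distances\<close>

text \<open>\<open>awalk_to_apath\<close> only cuts out closed subwalks. Hence any walk bounds a
  distance that is defined through paths.\<close>

lemma (in wf_digraph) length_awalk_to_apath:
  assumes "awalk u p v"
  shows "length (awalk_to_apath p) \<le> length p"
  using assms
proof (induct rule: awalk_to_apath_induct)
  case (path p)
  then show ?case by (auto simp: awalk_to_apath.simps)
next
  case (decomp p q r s)
  then have "p = q @ r @ s"
    using awalk_cyc_decomp_has_prop[of u p v] by auto
  then show ?case
    using decomp step_awalk_to_apath[of u p v q r s] by simp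
qed

text \<open>With its converse, this trades walks for powers of adjacency, where concatenation and
  reversal are easy.\<close>

lemma (in wf_digraph) awalk_imp_relpow:
  "awalk u p v \<Longrightarrow> (u, v) \<in> arcs_ends G ^^ length p"
proof (induct p arbitrary: u)
  case Nil
  then show ?case by (simp add: awalk_Nil_iff)
next
  case (Cons e p)
  then show ?case
    by (auto simp: awalk_Cons_iff simp del: relpow.simps
        intro!: relpow_Suc_I2 dest: in_arcs_imp_in_arcs_ends)
qed

text \<open>The hypothesis on \<open>u\<close> serves \<open>n = 0\<close>: the zeroth power relates
  every element of the type to itself, but an empty walk needs a vertex.\<close>

lemma (in wf_digraph) relpow_imp_awalk:
  assumes "(u, v) \<in> arcs_ends G ^^ n" "u \<in> verts G"
  shows "\<exists>p. awalk u p v \<and> length p = n"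
  using assms
proof (induct n arbitrary: u)
  case 0
  then show ?case by (auto simp: awalk_Nil_iff)
next
  case (Suc n)
  then obtain w where w: "u \<rightarrow> w" "(w, v) \<in> arcs_ends G ^^ n"
    by (blast elim: relpow_Suc_E2)
  then obtain p where "awalk w p v" "length p = n"
    using Suc.hyps by (blast intro: adj_in_verts)
  moreover obtain e where "e \<in> arcs G" "tail G e = u" "head G e = w"
    using w(1) by (auto simp: arcs_ends_def arc_to_ends_def)
  ultimately show ?case
    by (intro exI[of _ "e # p"]) (auto simp: awalk_Cons_iff)
qed

lemma (in wf_digraph) distance_le:
  assumes "(u, v) \<in> arcs_ends G ^^ n" "u \<in> verts G"
  shows "distance G u v \<le> n"
proof -
  obtain p where p: "awalk u p v" "length p = n"
    using relpow_imp_awalk[OF assms] by blast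
  then have "apath u (awalk_to_apath p) v" by (simp add: apath_awalk_to_apath)
  then have "distance G u v \<le> length (awalk_to_apath p)"
    unfolding distance_def by (blast intro: Least_le)
  also have "\<dots> \<le> n" using p length_awalk_to_apath by blast
  finally show ?thesis .
qed

text \<open>Reachability supplies a witness for the \<open>LEAST\<close> in \<open>distance\<close>.
  Together with \<open>distance_le\<close> this replaces the definition from here on.\<close>

lemma (in wf_digraph) relpow_distance:
  assumes "u \<rightarrow>\<^sup>* v"
  shows "(u, v) \<in> arcs_ends G ^^ distance G u v"
proof -
  obtain p where "apath u p v"
    using assms by (auto simp: reachable_awalk intro: apath_awalk_to_apath)
  then have "\<exists>n p. apath u p v \<and> length p = n" by blast
  then have "\<exists>q. apath u q v \<and> length q = distance G u v"
    unfolding distance_def by (rule LeastI_ex)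
  then obtain q where "apath u q v" "length q = distance G u v" by blast
  then show ?thesis using awalk_imp_relpow[of u q v] by (simp add: apath_def)
qed

lemma (in wf_digraph) distance_triangle:
  assumes "u \<rightarrow>\<^sup>* v" "v \<rightarrow>\<^sup>* w"
  shows "distance G u w \<le> distance G u v + distance G v w"
  using assms relpow_distance[OF assms(1)] relpow_distance[OF assms(2)]
  by (intro distance_le) (auto simp: relpow_add reachable_in_verts)

lemma (in wf_digraph) distance_self: "u \<in> verts G \<Longrightarrow> distance G u u = 0"
  using distance_le[of u u 0] by simp

lemma (in sym_digraph) reachable_sym: "u \<rightarrow>\<^sup>* v \<Longrightarrow> v \<rightarrow>\<^sup>* u"
  using symmetric_reachable[OF sym_arcs] .

lemma (in sym_digraph) relpow_arcs_ends_sym: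
  "(u, v) \<in> arcs_ends G ^^ n \<Longrightarrow> (v, u) \<in> arcs_ends G ^^ n"
proof (induct n arbitrary: v)
  case (Suc n)
  then show ?case by (blast intro: relpow_Suc_I2 elim: relpow_Suc_E dest: graph_symmetric)
qed simp

lemma (in sym_digraph) distance_sym:
  assumes "u \<rightarrow>\<^sup>* v"
  shows "distance G u v = distance G v u"
  using distance_le[OF relpow_arcs_ends_sym[OF relpow_distance[OF assms]]]
    distance_le[OF relpow_arcs_ends_sym[OF relpow_distance[OF reachable_sym[OF assms]]]]
    reachable_in_verts[OF assms] by simp

lemma (in loopfree_digraph) distance_eq_1_iff:
  assumes "u \<rightarrow>\<^sup>* v"
  shows "distance G u v = 1 \<longleftrightarrow> u \<rightarrow> v"
proof
  assume "distance G u v = 1"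
  then show "u \<rightarrow> v" using relpow_distance[OF assms] by simp
next
  assume uv: "u \<rightarrow> v"
  then have "distance G u v \<le> 1" by (intro distance_le) auto
  moreover have "distance G u v \<noteq> 0"
    using relpow_distance[OF assms] uv by (metis adj_not_same relpow_0_E)
  ultimately show "distance G u v = 1" by simp
qed

text \<open>Indexing a shortest walk by \<open>nat\<close> turns its distances into index
  arithmetic. By the triangle inequality, a shortcut between \<open>f i\<close> and
  \<open>f j\<close> would be a shortcut from \<open>u\<close> to \<open>v\<close>.\<close>

lemma (in wf_digraph) geodesic:
  assumes "u \<rightarrow>\<^sup>* v"
  obtains f where "f 0 = u" "f (distance G u v) = v"
    "\<And>i. i < distance G u v \<Longrightarrow> f i \<rightarrow> f (Suc i)"
    "\<And>i. i \<le> distance G u v \<Longrightarrow> f i \<in> verts G"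
    "\<And>i j. i \<le> j \<Longrightarrow> j \<le> distance G u v \<Longrightarrow> distance G (f i) (f j) = j - i"
proof -
  let ?D = "distance G u v"
  obtain f where f: "f 0 = u" "f ?D = v" "\<And>i. i < ?D \<Longrightarrow> f i \<rightarrow> f (Suc i)"
    using relpow_distance[OF assms] by (auto simp: relpow_fun_conv)
  have rel: "(f i, f j) \<in> arcs_ends G ^^ (j - i)" if "i \<le> j" "j \<le> ?D" for i j
    unfolding relpow_fun_conv using that f(3)
    by (intro exI[of _ "\<lambda>k. f (i + k)"]) auto
  have v: "f i \<in> verts G" if "i \<le> ?D" for i
  proof (cases "i = ?D")
    case True
    then show ?thesis using assms f(2) by (auto dest: reachable_in_verts)
  next
    case False
    then show ?thesis using that f(3)[of i] by (auto dest: adj_in_verts)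
  qed
  have reach: "f i \<rightarrow>\<^sup>* f j" if "i \<le> j" "j \<le> ?D" for i j
    using relpow_imp_awalk[OF rel[OF that] v[of i]] that by (auto simp: reachable_awalk)
  have le: "distance G (f i) (f j) \<le> j - i" if "i \<le> j" "j \<le> ?D" for i j
    using that by (intro distance_le rel v) auto
  have "distance G (f i) (f j) = j - i" if ij: "i \<le> j" "j \<le> ?D" for i j
  proof -
    have "?D \<le> distance G (f 0) (f i) + distance G (f i) (f ?D)"
      using distance_triangle[of "f 0" "f i" "f ?D"] reach[of 0 i] reach[of i ?D] ij f(1,2) by simp
    also have "distance G (f i) (f ?D) \<le> distance G (f i) (f j) + distance G (f j) (f ?D)"
      using distance_triangle[of "f i" "f j" "f ?D"] reach[of i j] reach[of j ?D] ij by simp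
    finally show ?thesis using le[of 0 i] le[of j ?D] le[OF ij] ij by simp
  qed
  with f v show ?thesis using that by blast
qed

lemma (in wf_digraph) reachable_seq:
  assumes "m \<le> n" "\<And>i. m \<le> i \<Longrightarrow> i < n \<Longrightarrow> h i \<rightarrow> h (Suc i)" "h m \<in> verts G"
  shows "h m \<rightarrow>\<^sup>* h n"
  using assms
proof (induct n rule: dec_induct)
  case (step n)
  then show ?case by (auto intro: reachable_adj_trans)
qed auto

subsection \<open>Connectedness and blocks\<close>

lemma (in sym_digraph) connected_iff_reachable:
  "Digraph_Component.connected G \<longleftrightarrow>
    verts G \<noteq> {} \<and> (\<forall>u \<in> verts G. \<forall>v \<in> verts G. u \<rightarrow>\<^sup>* v)"
  by (simp add: Digraph_Component.connected_def strongly_connected_def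
      reachable_mk_symmetric_eq[OF sym_arcs])

lemma (in sym_digraph) connected_if_reachable_root:
  assumes "r \<in> verts G" "\<And>v. v \<in> verts G \<Longrightarrow> r \<rightarrow>\<^sup>* v"
  shows "Digraph_Component.connected G"
  using assms unfolding connected_iff_reachable by (blast intro: reachable_sym reachable_trans)

lemma (in graph) graph_induce_subgraph:
  assumes "S \<subseteq> verts G"
  shows "graph (G \<restriction> S)"
proof -
  have ind: "induced_subgraph (G \<restriction> S) G" using assms by (rule induced_induce)
  interpret S: sym_digraph "G \<restriction> S" using ind by (rule induced_graph_imp_graph)
  interpret D: digraph "G \<restriction> S" using ind by (intro digraph_subgraph induced_imp_subgraph)
  show ?thesis by unfold_locales
qed

lemma dominates_induce_subgraph_iff:
  "u \<rightarrow>\<^bsub>G \<restriction> S\<^esub> v \<longleftrightarrow> u \<rightarrow>\<^bsub>G\<^esub> v \<and> u \<in> S \<and> v \<in> S"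
  by (auto simp: arcs_ends_def arc_to_ends_def)

text \<open>Lets the vertex deletions in \<open>two_connected\<close> be treated as changes of the
  inducing vertex set.\<close>

lemma del_vert_induce_subgraph:
  "pre_digraph.del_vert (G \<restriction> S) v = G \<restriction> (S - {v})"
  by (rule pre_digraph.equality) (auto simp: pre_digraph.del_vert_def)

text \<open>Among the finitely large candidates containing \<open>H\<close>, one with the most
  vertices and arcs together cannot be enlarged.\<close>

lemma (in fin_digraph) ex_max_subgraph:
  assumes "subgraph H G" "P H"
  shows "\<exists>B. max_subgraph P B \<and> subgraph H B"
proof -
  let ?Q = "\<lambda>B. subgraph H B \<and> subgraph B G \<and> P B"
  let ?m = "\<lambda>B. card (verts B) + card (arcs B)"
  have fin: "finite (verts B)" "finite (arcs B)" if "subgraph B G" for B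
    using that finite_subset[OF _ finite_verts] finite_subset[OF _ finite_arcs]
    by (auto simp: subgraph_def)
  have "?Q H"
    using assms by (auto simp: subgraph_def compatible_def)
  moreover have "\<forall>B. ?Q B \<longrightarrow> ?m B < Suc (?m G)"
    by (auto simp: subgraph_def less_Suc_eq_le intro!: add_mono card_mono)
  ultimately obtain B where B: "?Q B" "\<forall>B'. ?Q B' \<longrightarrow> ?m B' \<le> ?m B"
    using ex_has_greatest_nat[of ?Q H ?m "Suc (?m G)"] by blast
  have "B' = B" if B': "subgraph B B'" "subgraph B' G" "P B'" for B'
  proof -
    have "?Q B'" using B(1) B' subgraph_trans[of H B B'] by blast
    then have le: "?m B' \<le> ?m B" using B(2) by blast
    have sub: "verts B \<subseteq> verts B'" "arcs B \<subseteq> arcs B'"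
      using B'(1) by (auto simp: subgraph_def)
    then have "card (verts B) \<le> card (verts B')" "card (arcs B) \<le> card (arcs B')"
      using fin[OF B'(2)] by (auto intro: card_mono)
    with le have "card (verts B') \<le> card (verts B)" "card (arcs B') \<le> card (arcs B)"
      by linarith+
    with sub fin[OF B'(2)] have "verts B = verts B'" "arcs B = arcs B'"
      using card_seteq[of "verts B'" "verts B"] card_seteq[of "arcs B'" "arcs B"] by simp_all
    then show ?thesis
      using B'(1) by (intro pre_digraph.equality) (auto simp: subgraph_def compatible_def)
  qed
  then have "max_subgraph P B" unfolding max_subgraph_def using B(1) by metis
  then show ?thesis using B(1) by metis
qed

text \<open>\<open>H\<close> extends to a block, which is complete, and adjacency there persists in
  \<open>G\<close>.\<close>

lemma (in graph) two_connected_subgraph_adj: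
  assumes "block_graph G" "subgraph H G" "two_connected H"
    and "u \<in> verts H" "v \<in> verts H" "u \<noteq> v"
  shows "u \<rightarrow> v"
proof -
  obtain B where B: "max_subgraph two_connected B" "subgraph H B"
    using ex_max_subgraph[of H two_connected, OF assms(2,3)] by metis
  then have "complete B" using assms(1) by (auto simp: block_graph_def block_def)
  moreover have "u \<in> verts B" "v \<in> verts B" using B(2) assms(4,5) by (auto simp: subgraph_def)
  ultimately have "u \<rightarrow>\<^bsub>B\<^esub> v"
    using assms(6) by (auto simp: complete_def complete_digraph_def)
  moreover have "subgraph B G" using B(1) by (simp add: max_subgraph_def)
  ultimately show ?thesis by (rule adj_mono)
qed

text \<open>A shortest path from \<open>a\<close> to \<open>b\<close> avoiding \<open>p\<close> closes up to a cycle through \<open>p\<close>, and a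
  cycle lies in a block.\<close>
lemma (in graph) block_graph_adj_if_not_separated:
  assumes bg: "block_graph G" and pa: "p \<rightarrow> a" and pb: "p \<rightarrow> b" and ab: "a \<noteq> b"
    and reach: "a \<rightarrow>\<^sup>*\<^bsub>G \<restriction> (verts G - {p})\<^esub> b"
  shows "a \<rightarrow> b"
proof -
  let ?H = "G \<restriction> (verts G - {p})"
  interpret H: graph ?H by (rule graph_induce_subgraph) blast
  let ?n = "distance ?H a b"
  obtain h where h: "h 0 = a" "h ?n = b" "\<And>i. i < ?n \<Longrightarrow> h i \<rightarrow>\<^bsub>?H\<^esub> h (Suc i)"
    "\<And>i. i \<le> ?n \<Longrightarrow> h i \<in> verts ?H"
    "\<And>i j. i \<le> j \<Longrightarrow> j \<le> ?n \<Longrightarrow> distance ?H (h i) (h j) = j - i"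
    using H.geodesic[OF reach] by blast
  \<comment> \<open>As \<open>h\<close> is shortest, its vertices are distinct, so deleting one
    vertex breaks it in one place only.\<close>
  have inj: "h i \<noteq> h j" if "i < j" "j \<le> ?n" for i j
    using h(4)[of i] h(5)[of i j] that H.distance_self[of "h i"] by auto
  have adj: "h i \<rightarrow> h (Suc i)" if "i < ?n" for i
    using h(3)[OF that] by (rule dominates_induce_subgraphD)
  have hp: "h i \<in> verts G" "h i \<noteq> p" if "i \<le> ?n" for i using h(4)[OF that] by auto
  define C where "C = insert p (h ` {..?n})"
  have C: "C \<subseteq> verts G" using pa hp by (auto simp: C_def)
  have seg: "h i \<rightarrow>\<^sup>*\<^bsub>G \<restriction> S\<^esub> h j" if "i \<le> j" "j \<le> ?n" "h ` {i..j} \<subseteq> S" "S \<subseteq> verts G" for i j S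
  proof -
    interpret S: graph "G \<restriction> S" using that(4) by (rule graph_induce_subgraph)
    show ?thesis
      using that by (intro S.reachable_seq) (auto simp: dominates_induce_subgraph_iff image_subset_iff intro: adj)
  qed
  \<comment> \<open>Empty \<open>X\<close> gives connectedness of the graph induced on the cycle, a
    singleton \<open>X\<close> gives its vertex deletions.\<close>
  have conn: "Digraph_Component.connected (G \<restriction> (C - X))" if X: "X \<subseteq> {x}" for X x
  proof -
    have sub: "C - X \<subseteq> verts G" using C by blast
    interpret S: graph "G \<restriction> (C - X)" using sub by (rule graph_induce_subgraph)
    show ?thesis
    proof (cases "p \<in> X")
      case True
      then have CX: "C - X = h ` {..?n}" using X hp by (auto simp: C_def)
      have "a \<rightarrow>\<^sup>*\<^bsub>G \<restriction> (C - X)\<^esub> v" if "v \<in> C - X" for v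
      proof -
        obtain i where i: "i \<le> ?n" "v = h i" using \<open>v \<in> C - X\<close> unfolding CX by auto
        then have "h ` {0..i} \<subseteq> C - X" unfolding CX by auto
        then show ?thesis using seg[of 0 i] i h(1) sub by simp
      qed
      moreover have "a \<in> C - X" using h(1) unfolding CX by auto
      ultimately show ?thesis by (intro S.connected_if_reachable_root) auto
    next
      case False
      then have p: "p \<in> C - X" by (simp add: C_def)
      have "p \<rightarrow>\<^sup>*\<^bsub>G \<restriction> (C - X)\<^esub> h i" if i: "i \<le> ?n" "h i \<notin> X" for i
      \<comment> \<open>Of the two ways round the cycle from \<open>h i\<close> to \<open>p\<close>,
        one survives: upwards through \<open>b\<close> if the deleted vertex is some
        \<open>h k\<close> with \<open>k < i\<close>, otherwise downwards through
        \<open>a\<close>.\<close>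
      proof (cases "\<exists>k \<le> i. h k \<in> X")
        case True
        then obtain k where k: "k < i" "h k \<in> X" using i(2) by (metis le_neq_implies_less)
        have "h j \<notin> X" if "i \<le> j" "j \<le> ?n" for j
          using inj[of k j] that k X by auto
        then have seg': "h ` {i..?n} \<subseteq> C - X" by (auto simp: C_def)
        then have "h i \<rightarrow>\<^sup>*\<^bsub>G \<restriction> (C - X)\<^esub> b" using seg[of i ?n] i sub h(2) by simp
        moreover have "b \<in> C - X" using seg' h(2) i(1) by (metis atLeastAtMost_iff image_subset_iff order_refl)
        then have "p \<rightarrow>\<^bsub>G \<restriction> (C - X)\<^esub> b" using p pb by (simp add: dominates_induce_subgraph_iff)
        ultimately show ?thesis by (blast intro: S.reachable_sym S.adj_reachable_trans)
      next
        case False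
        then have seg': "h ` {0..i} \<subseteq> C - X" using i by (auto simp: C_def)
        then have "a \<rightarrow>\<^sup>*\<^bsub>G \<restriction> (C - X)\<^esub> h i" using seg[of 0 i] i sub h(1) by simp
        moreover have "a \<in> C - X"
          using seg' h(1) by (metis atLeastAtMost_iff image_subset_iff order_refl zero_le)
        then have "p \<rightarrow>\<^bsub>G \<restriction> (C - X)\<^esub> a" using p pa by (simp add: dominates_induce_subgraph_iff)
        ultimately show ?thesis by (blast intro: S.adj_reachable_trans)
      qed
      then have "p \<rightarrow>\<^sup>*\<^bsub>G \<restriction> (C - X)\<^esub> v" if "v \<in> C - X" for v
        using that p S.reachable_refl[of p] by (auto simp: C_def)
      then show ?thesis using p by (intro S.connected_if_reachable_root) auto
    qed
  qed
  have "Digraph_Component.connected (G \<restriction> C)"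
    using conn[of "{}"] by simp
  then have "two_connected (G \<restriction> C)"
    using graph_induce_subgraph[OF C] conn by (simp add: two_connected_def del_vert_induce_subgraph)
  moreover have "h 0 \<in> C" "h ?n \<in> C" by (auto simp: C_def)
  then have "a \<in> C" "b \<in> C" by (simp_all add: h(1,2))
  ultimately show ?thesis
    using two_connected_subgraph_adj[OF bg subgraph_induce_subgraphI[OF C]] ab by simp
qed

section \<open>Cut vertices on geodesics and the centre\<close>

text \<open>A geodesic from \<open>x\<close> to \<open>w\<close> cannot avoid \<open>z\<close> and
  so splits there. The cases \<open>z = x\<close> and \<open>z = w\<close> are included, as
  \<open>z\<close> is no vertex of the restricted graph.\<close>

lemma (in graph) distance_via_cut_vertex:
  assumes "x \<rightarrow>\<^sup>* w" "\<not> x \<rightarrow>\<^sup>*\<^bsub>G \<restriction> (verts G - {z})\<^esub> w"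
  shows "distance G x w = distance G x z + distance G z w"
proof -
  let ?d = "distance G x w"
  interpret H: graph "G \<restriction> (verts G - {z})" by (rule graph_induce_subgraph) blast
  obtain g where g: "g 0 = x" "g ?d = w" "\<And>i. i < ?d \<Longrightarrow> g i \<rightarrow> g (Suc i)"
    "\<And>i. i \<le> ?d \<Longrightarrow> g i \<in> verts G"
    "\<And>i j. i \<le> j \<Longrightarrow> j \<le> ?d \<Longrightarrow> distance G (g i) (g j) = j - i"
    using geodesic[OF assms(1)] by blast
  have "\<exists>i \<le> ?d. g i = z"
  proof (rule ccontr)
    assume "\<not> ?thesis"
    then have "g 0 \<rightarrow>\<^sup>*\<^bsub>G \<restriction> (verts G - {z})\<^esub> g ?d"
      using g(3,4) by (intro H.reachable_seq) (auto simp: dominates_induce_subgraph_iff)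
    then show False using assms(2) g(1,2) by simp
  qed
  then obtain i where "i \<le> ?d" "g i = z" by blast
  then show ?thesis using g(5)[of 0 i] g(5)[of i ?d] g(1,2) by simp
qed

text \<open>Otherwise the two neighbours of \<open>f k\<close> on the geodesic are joined avoiding
  \<open>f k\<close>, back to \<open>x\<close>, over to \<open>y\<close> and back again. They are
  then adjacent, although at distance two.\<close>

lemma (in graph) block_graph_geodesic_separates:
  assumes bg: "block_graph G" and xy: "x \<rightarrow>\<^sup>* y"
    and f: "f 0 = x" "f (distance G x y) = y"
      "\<And>i. i < distance G x y \<Longrightarrow> f i \<rightarrow> f (Suc i)"
      "\<And>i. i \<le> distance G x y \<Longrightarrow> f i \<in> verts G"
      "\<And>i j. i \<le> j \<Longrightarrow> j \<le> distance G x y \<Longrightarrow> distance G (f i) (f j) = j - i"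
    and k: "0 < k" "k < distance G x y"
  shows "\<not> x \<rightarrow>\<^sup>*\<^bsub>G \<restriction> (verts G - {f k})\<^esub> y"
proof
  let ?D = "distance G x y"
  let ?H = "G \<restriction> (verts G - {f k})"
  interpret H: graph ?H by (rule graph_induce_subgraph) blast
  assume xy': "x \<rightarrow>\<^sup>*\<^bsub>?H\<^esub> y"
  have ne: "f i \<noteq> f k" if "i \<le> ?D" "i \<noteq> k" for i
    using that f(5)[of i k] f(5)[of k i] k distance_self[of "f k"] f(4)[of k]
    by (cases "i < k") auto
  have seg: "f i \<rightarrow>\<^sup>*\<^bsub>?H\<^esub> f j" if "i \<le> j" "j \<le> ?D" "j < k \<or> k < i" for i j
    using that ne f(3,4) by (intro H.reachable_seq) (auto simp: dominates_induce_subgraph_iff)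
  have "f (k - 1) \<rightarrow>\<^sup>*\<^bsub>?H\<^esub> x" using seg[of 0 "k - 1"] k f(1) by (auto intro: H.reachable_sym)
  also note xy'
  also have "y \<rightarrow>\<^sup>*\<^bsub>?H\<^esub> f (Suc k)" using seg[of "Suc k" ?D] k f(2) by (auto intro: H.reachable_sym)
  finally have "f (k - 1) \<rightarrow>\<^sup>*\<^bsub>?H\<^esub> f (Suc k)" .
  moreover have "f k \<rightarrow> f (k - 1)" "f k \<rightarrow> f (Suc k)"
    using f(3)[of "k - 1"] f(3)[of k] k by (auto intro: graph_symmetric)
  moreover have d: "distance G (f (k - 1)) (f (Suc k)) = 2"
    using f(5)[of "k - 1" "Suc k"] k by simp
  then have "f (k - 1) \<noteq> f (Suc k)"
    using distance_self[of "f (Suc k)"] f(4)[of "Suc k"] k by auto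
  ultimately have "f (k - 1) \<rightarrow> f (Suc k)"
    using block_graph_adj_if_not_separated[OF bg] by blast
  then show False using d distance_eq_1_iff[of "f (k - 1)" "f (Suc k)"] by auto
qed

text \<open>The centre is the middle \<open>z\<close> of a diametral path from \<open>x\<close> to \<open>y\<close>: since \<open>z\<close> separates
  \<open>x\<close> from \<open>y\<close>, it separates every vertex from \<open>x\<close> or from \<open>y\<close>.\<close>
lemma (in graph) block_graph_ex_center:
  assumes bg: "block_graph G" and conn: "Digraph_Component.connected G"
    and xy: "x \<in> verts G" "y \<in> verts G"
    and diam: "\<And>u v. u \<in> verts G \<Longrightarrow> v \<in> verts G \<Longrightarrow> distance G u v \<le> distance G x y"
  shows "\<exists>z \<in> verts G. \<forall>w \<in> verts G. distance G z w \<le> (distance G x y + 1) div 2"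
\<comment> \<open>A geodesic of length at most one has no inner vertex; there \<open>x\<close>
  itself is a centre.\<close>
proof (cases "distance G x y \<le> 1")
  case True
  then have "distance G x w \<le> (distance G x y + 1) div 2" if "w \<in> verts G" for w
    using diam[OF xy(1) that] by linarith
  then show ?thesis using xy(1) by blast
next
  case False
  let ?D = "distance G x y"
  have reach: "u \<rightarrow>\<^sup>* v" if "u \<in> verts G" "v \<in> verts G" for u v
    using conn that by (simp add: connected_iff_reachable)
  obtain f where f: "f 0 = x" "f ?D = y" "\<And>i. i < ?D \<Longrightarrow> f i \<rightarrow> f (Suc i)"
    "\<And>i. i \<le> ?D \<Longrightarrow> f i \<in> verts G"
    "\<And>i j. i \<le> j \<Longrightarrow> j \<le> ?D \<Longrightarrow> distance G (f i) (f j) = j - i"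
    using geodesic[OF reach[OF xy]] by blast
  \<comment> \<open>Any rounding of the half works: a \<open>w\<close> cut off from \<open>x\<close>
    gets the bound \<open>?D - k\<close>, one cut off from \<open>y\<close> the bound
    \<open>k\<close>, and the larger is half of \<open>?D\<close> rounded up.\<close>
  define k where "k = ?D div 2"
  have k: "0 < k" "k < ?D" using False by (auto simp: k_def)
  let ?H = "G \<restriction> (verts G - {f k})"
  interpret H: graph ?H by (rule graph_induce_subgraph) blast
  have z: "f k \<in> verts G" using f(4) k by simp
  have sep: "\<not> x \<rightarrow>\<^sup>*\<^bsub>?H\<^esub> y"
    using block_graph_geodesic_separates[OF bg reach[OF xy] f k] by blast
  have dxz: "distance G x (f k) = k" and dyz: "distance G y (f k) = ?D - k"
    using f(5)[of 0 k] f(5)[of k ?D] f(1,2) k distance_sym[OF reach[OF xy(2) z]] by auto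
  have "distance G (f k) w \<le> (?D + 1) div 2" if w: "w \<in> verts G" for w
  proof -
    \<comment> \<open>If \<open>w = f k\<close>, both alternatives hold, since \<open>f k\<close> is
      not in \<open>?H\<close>.\<close>
    consider "\<not> x \<rightarrow>\<^sup>*\<^bsub>?H\<^esub> w" | "\<not> y \<rightarrow>\<^sup>*\<^bsub>?H\<^esub> w"
      using sep by (blast intro: H.reachable_sym H.reachable_trans)
    then show ?thesis
    proof cases
      case 1
      then show ?thesis
        using distance_via_cut_vertex[OF reach[OF xy(1) w] 1] diam[OF xy(1) w] dxz
        unfolding k_def by linarith
    next
      case 2
      then show ?thesis
        using distance_via_cut_vertex[OF reach[OF xy(2) w] 2] diam[OF xy(2) w] dyz k
        unfolding k_def by linarith
    qed
  qed
  then show ?thesis using z by blast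
qed

subsection \<open>Independent sets along a geodesic\<close>

text \<open>The vertices of a geodesic \<open>f\<close> equal or adjacent to \<open>v\<close> have indices within distance one of
  some \<open>k\<close>; take every second vertex starting from either end of \<open>f\<close> up to distance two from
  \<open>f k\<close>, together with \<open>v\<close>.\<close>
lemma (in graph) ex_independent_set_ge_half_distance:
  assumes conn: "Digraph_Component.connected G"
    and xy: "x \<in> verts G" "y \<in> verts G" and v: "v \<in> verts G"
  shows "\<exists>S. independent_set G S \<and> v \<in> S \<and> (distance G x y + 1) div 2 \<le> card S"
proof -
  let ?D = "distance G x y"
  have reach: "u \<rightarrow>\<^sup>* v" if "u \<in> verts G" "v \<in> verts G" for u v
    using conn that by (simp add: connected_iff_reachable)
  obtain f where f: "\<And>i. i \<le> ?D \<Longrightarrow> f i \<in> verts G"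
    "\<And>i j. i \<le> j \<Longrightarrow> j \<le> ?D \<Longrightarrow> distance G (f i) (f j) = j - i"
    using geodesic[OF reach[OF xy]] by metis
  define N where "N = {i. i \<le> ?D \<and> distance G (f i) v \<le> 1}"
  \<comment> \<open>A detour through \<open>v\<close> joins \<open>f i\<close> to \<open>f j\<close>
    in at most two steps.\<close>
  have N: "j \<le> i + 2" if "i \<in> N" "j \<in> N" for i j
  proof (cases "i \<le> j")
    case True
    have ij: "i \<le> ?D" "j \<le> ?D" and le: "distance G (f i) v \<le> 1" "distance G (f j) v \<le> 1"
      using that by (auto simp: N_def)
    have "distance G (f i) (f j) \<le> distance G (f i) v + distance G v (f j)"
      using ij by (intro distance_triangle reach f(1) v)
    also have "distance G v (f j) = distance G (f j) v"
      using ij by (intro distance_sym reach f(1) v)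
    finally show ?thesis using le f(2)[OF True ij(2)] by simp
  qed simp
  obtain k where k: "k \<le> ?D" "\<And>i. i \<in> N \<Longrightarrow> k \<le> i + 1 \<and> i \<le> k + 1"
  proof (cases "N = {}")
    case True
    then show ?thesis using that[of 0] by simp
  next
    case False
    define m where "m = (LEAST i. i \<in> N)"
    have m: "m \<in> N" "\<And>i. i \<in> N \<Longrightarrow> m \<le> i"
      using False by (auto simp: m_def intro: LeastI Least_le)
    \<comment> \<open>\<open>N\<close> lies between its least element \<open>m\<close> and
      \<open>m + 2\<close>, so \<open>m + 1\<close> is a midpoint; the minimum keeps it an index of
      the geodesic.\<close>
    have "min (m + 1) ?D \<le> i + 1 \<and> i \<le> min (m + 1) ?D + 1" if "i \<in> N" for i
      using m(2)[OF that] N[OF m(1) that] that by (auto simp: N_def)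
    then show ?thesis using that[of "min (m + 1) ?D"] by simp
  qed
  \<comment> \<open>\<open>A\<close> is 0, 2, ... up to at most \<open>k - 2\<close>;
    \<open>B\<close> is \<open>?D\<close>, \<open>?D - 2\<close>, ... down to at least
    \<open>k + 2\<close>. Both miss the window around \<open>k\<close> that contains
    \<open>N\<close>.\<close>
  define A where "A = (\<lambda>j. 2 * j) ` {..<k div 2}"
  define B where "B = (\<lambda>j. ?D - 2 * j) ` {..<(?D - k) div 2}"
  have A: "i + 2 \<le> k \<and> even i" if "i \<in> A" for i using that by (auto simp: A_def)
  have B: "k + 2 \<le> i \<and> i \<le> ?D \<and> even (?D - i)" if "i \<in> B" for i using that k(1) by (auto simp: B_def)
  have AB_le: "i \<le> ?D" if "i \<in> A \<union> B" for i using that A[of i] B[of i] k(1) by auto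
  have AB_N: "i \<notin> N" if "i \<in> A \<union> B" for i using that A[of i] B[of i] k(2)[of i] by auto
  have AB_gap: "i + 2 \<le> j" if "i \<in> A \<union> B" "j \<in> A \<union> B" "i < j" for i j
  proof -
    \<comment> \<open>Parity is constant within \<open>A\<close> and within \<open>B\<close>, and
      between them lies a gap of at least four.\<close>
    have "j \<noteq> i + 1" using that A[of i] A[of j] B[of i] B[of j] by auto
    then show ?thesis using that(3) by simp
  qed
  have AB_dist: "2 \<le> distance G (f i) (f j)" if "i \<in> A \<union> B" "j \<in> A \<union> B" "i \<noteq> j" for i j
  proof (cases "i < j")
    case True
    then show ?thesis using AB_gap[of i j] that f(2)[of i j] AB_le by simp
  next
    case False
    then show ?thesis
      using AB_gap[of j i] that f(2)[of j i] AB_le distance_sym[OF reach, OF f(1) f(1), of i j] by simp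
  qed
  define S where "S = insert v (f ` (A \<union> B))"
  have far: "2 \<le> distance G a b" if ab: "a \<in> S" "b \<in> S" "a \<noteq> b" for a b
  proof -
    have far_v: "2 \<le> distance G (f i) v \<and> 2 \<le> distance G v (f i)" if "i \<in> A \<union> B" for i
      using AB_N[OF that] AB_le[OF that] distance_sym[OF reach[OF f(1) v], of i] by (simp add: N_def)
    show ?thesis using ab AB_dist far_v unfolding S_def by blast
  qed
  have SV: "S \<subseteq> verts G" using v AB_le f(1) by (auto simp: S_def)
  have "\<not> a \<rightarrow> b" if "a \<in> S" "b \<in> S" for a b
    using far[of a b] that distance_eq_1_iff[OF reach, of a b] SV adj_not_same[of a] by (cases "a = b") auto
  then have ind: "independent_set G S" using SV by (simp add: independent_set_def)
  have fin: "finite A" "finite B" by (auto simp: A_def B_def)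
  have inj: "inj_on f (A \<union> B)"
  proof (rule inj_onI, rule ccontr)
    fix i j assume ij: "i \<in> A \<union> B" "j \<in> A \<union> B" "f i = f j" "i \<noteq> j"
    then show False using AB_dist[of i j] distance_self[OF f(1)[OF AB_le[OF ij(1)]]] by simp
  qed
  \<comment> \<open>A chosen vertex equal to \<open>v\<close> would have distance zero from it,
    putting its index into \<open>N\<close>.\<close>
  have "v \<notin> f ` (A \<union> B)"
  proof
    assume "v \<in> f ` (A \<union> B)"
    then obtain i where i: "i \<in> A \<union> B" "v = f i" by blast
    then show False using AB_N[OF i(1)] AB_le[OF i(1)] distance_self[OF v] by (simp add: N_def)
  qed
  then have "card S = Suc (card (A \<union> B))"
    using fin inj by (simp add: S_def card_image)
  also have "card (A \<union> B) = card A + card B"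
    using fin A B by (intro card_Un_disjoint) force+
  also have "card A = k div 2" by (simp add: A_def card_image inj_on_def)
  also have "card B = (?D - k) div 2"
    unfolding B_def by (subst card_image) (auto simp: inj_on_def)
  \<comment> \<open>The two roundings lose at most one in total, and only one half if
    \<open>?D\<close> is odd; counting \<open>v\<close> makes up for it.\<close>
  finally have "(?D + 1) div 2 \<le> card S" using k(1) by linarith
  then show ?thesis using ind by (auto simp: S_def)
qed

section \<open>Comparison of radius and independence number\<close>

lemma (in graph) radius_le_alpha_min:
  assumes bg: "block_graph G" and conn: "Digraph_Component.connected G"
  shows "radius G \<le> alpha_min G"
proof -
  have ne: "verts G \<noteq> {}" using conn by (simp add: connected_iff_reachable)
  let ?P = "verts G \<times> verts G"
  have "Max ((\<lambda>(u, v). distance G u v) ` ?P) \<in> (\<lambda>(u, v). distance G u v) ` ?P"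
    using ne by (intro Max_in) auto
  then obtain x y where xy: "x \<in> verts G" "y \<in> verts G"
    "distance G x y = Max ((\<lambda>(u, v). distance G u v) ` ?P)" by auto
  then have diam: "distance G u v \<le> distance G x y" if "u \<in> verts G" "v \<in> verts G" for u v
    using that by (auto intro!: Max_ge)
  \<comment> \<open>Half the diameter rounded up, where the bound on the radius meets the bound on
    every \<open>alpha_at G v\<close>.\<close>
  let ?r = "(distance G x y + 1) div 2"
  obtain z where z: "z \<in> verts G" "\<And>w. w \<in> verts G \<Longrightarrow> distance G z w \<le> ?r"
    using block_graph_ex_center[OF bg conn xy(1,2) diam] by blast
  have "radius G \<le> eccentricity G z"
    unfolding radius_def using z(1) by (intro Min_le) auto
  also have "eccentricity G z \<le> ?r"
    unfolding eccentricity_def using ne z(2) by (subst Max_le_iff) auto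
  also have "?r \<le> alpha_min G"
    unfolding alpha_min_def
  proof (subst Min_ge_iff; (intro ballI)?)
    fix a assume "a \<in> alpha_at G ` verts G"
    then obtain v where v: "v \<in> verts G" "a = alpha_at G v" by blast
    obtain S where S: "independent_set G S" "v \<in> S" "?r \<le> card S"
      using ex_independent_set_ge_half_distance[OF conn xy(1,2) v(1)] by blast
    have "finite {S. independent_set G S \<and> v \<in> S}"
      by (rule finite_subset[of _ "Pow (verts G)"]) (auto simp: independent_set_def)
    then have "card S \<le> alpha_at G v"
      unfolding alpha_at_def using S by (intro Max_ge) auto
    then show "?r \<le> a" using S(3) v(2) by simp
  qed (use ne in auto)
  finally show ?thesis .
qed

theorem theorem8:
  fixes G :: "('a,'b) pre_digraph"
  assumes "graph G" and "Digraph_Component.connected G" and "block_graph G"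
  shows "radius G \<le> alpha_min G"
  using graph.radius_le_alpha_min assms by blast

end
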